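(* Let $G$ be a simple graph with $n$ vertices, $m$ edges, minimum degree $\delta$ and maximum degree $\Delta$, and let $\Theta=\det S(G)$. Then $$\sqrt{\frac{m\delta^2}{2}+n(n-1)\,|\Theta|^{2/n}}\;\le\; E_{\mathrm{ISI}}(G)\;\le\;\sqrt{m(n-1)\,\frac{\Delta^2}{2}+n\,|\Theta|^{2/n}}.$$
   Context: For a simple graph $G$ with vertices $v_1,\dots,v_n$, let $d_i$ be the degree of $v_i$. The ISI matrix $S(G)=[s_{ij}]_{n\times n}$ has $s_{ij}=\frac{d_id_j}{d_i+d_j}$ if $v_i$ and $v_j$ are adjacent and $s_{ij}=0$ otherwise. The ISI energy is $E_{\mathrm{ISI}}(G)=\sum_{i=1}^n|\tau_i|$, where $\tau_1,\dots,\tau_n$ are the eigenvalues of $S(G)$ counted with multiplicity. *)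

theory Defs
  imports
    "Graph_Theory.Digraph"
    "Jordan_Normal_Form.Char_Poly"
    "HOL-Computational_Algebra.Fundamental_Theorem_Algebra"
begin

text \<open>
  A finite simple graph is a graph in the sense of the locale \<^locale>\<open>graph\<close>: a finite symmetric
  digraph without loops and without parallel arcs. Every undirected edge is thus a pair of
  opposite arcs, so \<^const>\<open>out_degree\<close> is the usual vertex degree, whereas the number of
  undirected edges is half the number of arcs; it is obtained here by counting the
  unordered pairs of adjacent vertices.
\<close>

definition edge_count :: "('a, 'b) pre_digraph \<Rightarrow> nat" where
  "edge_count G = card {{u, w} | u w. u \<rightarrow>\<^bsub>G\<^esub> w}"

definition min_degree :: "('a, 'b) pre_digraph \<Rightarrow> nat" where
  "min_degree G = Min (out_degree G ` verts G)"

definition max_degree :: "('a, 'b) pre_digraph \<Rightarrow> nat" where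
  "max_degree G = Max (out_degree G ` verts G)"

text \<open>
  The vertices are numbered \<open>v 0, \<dots>, v (n - 1)\<close>; the function \<open>v\<close> is meant to be a bijection from
  \<open>{..<n}\<close> to the vertex set, where \<open>n\<close> is the number of vertices.
\<close>

definition ISI_matrix :: "('a, 'b) pre_digraph \<Rightarrow> (nat \<Rightarrow> 'a) \<Rightarrow> real mat" where
  "ISI_matrix G v = mat (card (verts G)) (card (verts G)) (\<lambda>(i, j).
     if v i \<rightarrow>\<^bsub>G\<^esub> v j
     then real (out_degree G (v i)) * real (out_degree G (v j)) /
          (real (out_degree G (v i)) + real (out_degree G (v j)))
     else 0)"

text \<open>
  The eigenvalues with algebraic multiplicity, as a multiset. They are taken over the complex
  numbers, so that an \<open>n \<times> n\<close> matrix has exactly \<open>n\<close> of them by construction, without appealing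
  to the fact that those of a real symmetric matrix are real.
\<close>

definition eigenvalues_mset :: "real mat \<Rightarrow> complex multiset" where
  "eigenvalues_mset A = proots (char_poly (map_mat complex_of_real A))"

definition ISI_energy :: "('a, 'b) pre_digraph \<Rightarrow> (nat \<Rightarrow> 'a) \<Rightarrow> real" where
  "ISI_energy G v = (\<Sum>\<tau>\<in>#eigenvalues_mset (ISI_matrix G v). cmod \<tau>)"

end

theory Submission
  imports Defs "Jordan_Normal_Form.Schur_Decomposition" "HOL-Analysis.Convex"
begin

text \<open>
  As \<open>S(G)\<close> is real symmetric, its eigenvalues satisfy \<open>\<Sum>\<tau>\<^sup>2 = tr S(G)\<^sup>2\<close>, and every entry belonging to an
  edge lies between \<open>\<delta>/2\<close> and \<open>\<Delta>/2\<close>, so this trace lies between \<open>m\<delta>\<^sup>2/2\<close> and \<open>m\<Delta>\<^sup>2/2\<close>. Both bounds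
  then come from Kober's refinements of the Cauchy-Schwarz inequality for \<open>(\<Sum>\<bar>\<tau>\<bar>)\<^sup>2\<close>, in which
  \<open>\<bar>\<Theta>\<bar>\<close> enters as the product of the \<open>\<bar>\<tau>\<bar>\<close>.
\<close>

section \<open>Kober's inequalities\<close>

text \<open>The geometric mean enters as a nonnegative number \<open>g\<close> with a prescribed
  power, so later applications only have to verify a power identity and may have zero
  factors.\<close>

lemma geometric_le_arithmetic_mean:
  fixes x :: "'a \<Rightarrow> real" and g :: real
  assumes "finite A" and "\<And>i. i \<in> A \<Longrightarrow> 0 \<le> x i"
    and "0 \<le> g" and g: "g ^ card A = (\<Prod>i\<in>A. x i)"
  shows "real (card A) * g \<le> (\<Sum>i\<in>A. x i)"
proof (cases "A = {}")
  case False
  let ?k = "card A"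
  have k: "0 < ?k" using False assms(1) by (simp add: card_gt_0_iff)
  have "(\<Prod>i\<in>A. x i) powr (1 / real ?k) = g"
  proof (cases "g = 0")
    case True
    then show ?thesis using g k by (simp flip: g)
  next
    case False
    then show ?thesis using \<open>0 \<le> g\<close> k by (simp flip: g add: powr_realpow[symmetric] powr_powr)
  qed
  then have "g \<le> (\<Sum>i\<in>A. x i / real ?k)"
    using arith_geom_mean[OF assms(1) False, of x] assms(2) by simp
  then show ?thesis using k by (simp add: sum_divide_distrib[symmetric] field_simps)
qed simp

text \<open>This is the mean inequality for \<open>p\<close> copies of \<open>a\<close> and
  \<open>q\<close> copies of \<open>b\<close>, laid out as a family indexed by the numbers below
  \<open>p + q\<close>.\<close>

lemma weighted_geometric_le_arithmetic_mean:
  fixes a b g :: real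
  assumes "0 \<le> a" "0 \<le> b" "0 \<le> g" and g: "g ^ (p + q) = a ^ p * b ^ q"
  shows "real (p + q) * g \<le> real p * a + real q * b"
proof -
  let ?x = "\<lambda>i. if i < p then a else b"
  have split: "{..<p + q} = {..<p} \<union> {p..<p + q}" by auto
  have "(\<Prod>i<p + q. ?x i) = (\<Prod>i<p. ?x i) * (\<Prod>i=p..<p + q. ?x i)"
    unfolding split by (rule prod.union_disjoint) auto
  then have "g ^ card {..<p + q} = (\<Prod>i<p + q. ?x i)" using g by simp
  moreover have "(\<Sum>i<p + q. ?x i) = (\<Sum>i<p. ?x i) + (\<Sum>i=p..<p + q. ?x i)"
    unfolding split by (rule sum.union_disjoint) auto
  ultimately show ?thesis
    using geometric_le_arithmetic_mean[of "{..<p + q}" ?x g] assms(1-3) by simp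
qed

text \<open>Induction on the set: with \<open>c\<close> the new element and \<open>k\<close>,
  \<open>h\<close>, \<open>S\<close> the size, geometric mean and sum of the rest, the step needs
  k(k+1)g^2 \<le> k(k-1)h^2 + 2cS. This follows from S \<ge> kh and the mean inequality for k-1
  copies of h^2 and two copies of ch, whose product is (g^2)^(k+1).\<close>

lemma kober_lower:
  fixes x :: "'a \<Rightarrow> real" and g :: real
  assumes "finite A" "A \<noteq> {}" and "\<And>i. i \<in> A \<Longrightarrow> 0 \<le> x i"
    and "0 \<le> g" and "g ^ card A = (\<Prod>i\<in>A. x i)"
  shows "(\<Sum>i\<in>A. (x i)\<^sup>2) + real (card A) * (real (card A) - 1) * g\<^sup>2 \<le> (\<Sum>i\<in>A. x i)\<^sup>2"
  using assms
proof (induction A arbitrary: g rule: finite_ne_induct)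
  case (singleton a)
  then show ?case by simp
next
  case (insert a A)
  let ?k = "card A" and ?c = "x a" and ?S = "\<Sum>i\<in>A. x i"
  have k: "0 < ?k" using insert by (simp add: card_gt_0_iff)
  define h where "h = root ?k (\<Prod>i\<in>A. x i)"
  have c: "0 \<le> ?c" and prod: "0 \<le> (\<Prod>i\<in>A. x i)"
    using insert.prems by (auto intro: prod_nonneg)
  have h: "0 \<le> h" "h ^ ?k = (\<Prod>i\<in>A. x i)"
    using k prod by (auto simp: h_def)
  have IH: "(\<Sum>i\<in>A. (x i)\<^sup>2) + real ?k * (real ?k - 1) * h\<^sup>2 \<le> ?S\<^sup>2"
    using insert.prems h by (intro insert.IH) auto
  have "real ?k * h \<le> ?S"
    using insert h by (intro geometric_le_arithmetic_mean) auto
  then have S: "2 * ?c * (real ?k * h) \<le> 2 * ?c * ?S" using c by (intro mult_left_mono) auto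
  have gk: "g ^ (?k + 1) = h ^ ?k * ?c" using insert h by simp
  have "?k - 1 + 2 = ?k + 1" using k by simp
  then have "(g\<^sup>2) ^ (?k - 1 + 2) = (g ^ (?k + 1))\<^sup>2"
    by (simp only: power_mult[symmetric] mult.commute)
  also have "\<dots> = (h\<^sup>2) ^ ?k * ?c\<^sup>2"
    by (simp only: gk power_mult_distrib) (simp add: power_mult[symmetric] mult.commute)
  also have "(h\<^sup>2) ^ ?k = (h\<^sup>2) ^ (?k - 1) * h\<^sup>2" using k by (metis power_minus_mult)
  also have "(h\<^sup>2) ^ (?k - 1) * h\<^sup>2 * ?c\<^sup>2 = (h\<^sup>2) ^ (?k - 1) * (?c * h)\<^sup>2"
    by (simp add: power_mult_distrib)
  finally have "real (?k - 1 + 2) * g\<^sup>2 \<le> real (?k - 1) * h\<^sup>2 + real 2 * (?c * h)"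
    using c h by (intro weighted_geometric_le_arithmetic_mean) auto
  then have "(real ?k + 1) * g\<^sup>2 \<le> (real ?k - 1) * h\<^sup>2 + 2 * (?c * h)"
    using k by (simp add: of_nat_diff add.commute)
  then have "real ?k * ((real ?k + 1) * g\<^sup>2) \<le> real ?k * ((real ?k - 1) * h\<^sup>2 + 2 * (?c * h))"
    by (intro mult_left_mono) auto
  with IH S insert show ?case
    by (simp add: power2_sum) (simp add: algebra_simps)
qed

text \<open>
  The induction removes a minimal element \<open>c\<close>: only then is the geometric mean \<open>h\<close> of the others
  at least \<open>c\<close>, which gives \<open>(\<Sum>(x i - c)\<^sup>2) \<ge> k * (h - c)\<^sup>2\<close>.
\<close>

lemma kober_upper:
  fixes x :: "'a \<Rightarrow> real" and g :: real
  assumes "finite A" "A \<noteq> {}" and "\<And>i. i \<in> A \<Longrightarrow> 0 \<le> x i"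
    and "0 \<le> g" and "g ^ card A = (\<Prod>i\<in>A. x i)"
  shows "(\<Sum>i\<in>A. x i)\<^sup>2 \<le> (real (card A) - 1) * (\<Sum>i\<in>A. (x i)\<^sup>2) + real (card A) * g\<^sup>2"
  using assms
proof (induction A arbitrary: g rule: finite_ranking_induct[where f = "\<lambda>i. - x i"])
  case empty
  then show ?case by simp
next
  case (insert a A)
  \<comment> \<open>Ranking by \<open>- x i\<close> makes \<open>a\<close> minimal, but the rule
    does not provide that \<open>a\<close> is new; the empty set is separate because the induction
    hypothesis excludes it.\<close>
  consider "A = {}" | "a \<in> A" | (new) "A \<noteq> {}" "a \<notin> A" by blast
  then show ?case
  proof cases
    case 1
    then show ?thesis using insert by simp
  next
    case 2
    then have "insert a A = A" "A \<noteq> {}" by auto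
    then show ?thesis using insert.IH[of g] insert.prems by simp
  next
    case A: new
    let ?k = "card A" and ?c = "x a" and ?S = "\<Sum>i\<in>A. x i" and ?Q = "\<Sum>i\<in>A. (x i)\<^sup>2"
    have k: "0 < ?k" using insert A by (simp add: card_gt_0_iff)
    define h where "h = root ?k (\<Prod>i\<in>A. x i)"
    have c: "0 \<le> ?c" and prod: "0 \<le> (\<Prod>i\<in>A. x i)"
      using insert.prems by (auto intro: prod_nonneg)
    have h: "0 \<le> h" "h ^ ?k = (\<Prod>i\<in>A. x i)"
      using k prod by (auto simp: h_def)
    have IH: "?S\<^sup>2 \<le> (real ?k - 1) * ?Q + real ?k * h\<^sup>2"
      using insert.prems h A by (intro insert.IH) auto
    have S: "real ?k * h \<le> ?S"
      using insert h by (intro geometric_le_arithmetic_mean) auto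
    have "(\<Prod>i\<in>A. ?c) \<le> (\<Prod>i\<in>A. x i)"
      using c insert.hyps by (intro prod_mono) auto
    then have "?c ^ ?k \<le> h ^ ?k" using h by simp
    then have ch: "?c \<le> h" using power_mono_iff[OF c h(1) k] by simp
    have gk: "g ^ (?k + 1) = h ^ ?k * ?c" using insert A h by simp
    \<comment> \<open>The weights k-1 for c^2 and k+1 for g^2 make ch the geometric mean of these 2k
      numbers, since g^(k+1) = h^k c.\<close>
    have "(?c * h) ^ (?k - 1 + (?k + 1)) = ?c ^ (?k - 1 + (?k + 1)) * h ^ (?k + ?k)"
      using k by (simp add: power_mult_distrib)
    also have "\<dots> = (?c ^ (?k - 1) * ?c ^ (?k - 1)) * (h ^ ?k * ?c) * (h ^ ?k * ?c)"
      using k by (simp only: power_add) (simp add: power_eq_if algebra_simps)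
    also have "\<dots> = (?c\<^sup>2) ^ (?k - 1) * (g\<^sup>2) ^ (?k + 1)"
      unfolding gk[symmetric] by (simp add: power2_eq_square power_mult_distrib mult_ac)
    finally have "real (?k - 1 + (?k + 1)) * (?c * h) \<le> real (?k - 1) * ?c\<^sup>2 + real (?k + 1) * g\<^sup>2"
      using c h by (intro weighted_geometric_le_arithmetic_mean) auto
    then have gm: "2 * real ?k * (?c * h) \<le> (real ?k - 1) * ?c\<^sup>2 + (real ?k + 1) * g\<^sup>2"
      using k by (simp add: of_nat_diff algebra_simps)
    \<comment> \<open>The parabola t \<mapsto> (t-c)^2 lies above its tangent at t = h. After
      summation the linear term is nonnegative because h \<ge> c and S \<ge> kh.\<close>
    have tangent: "(x i - ?c)\<^sup>2 \<ge> (h - ?c)\<^sup>2 + 2 * (h - ?c) * (x i - h)" for i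
      using zero_le_power2[of "x i - h"] by (simp add: power2_eq_square algebra_simps)
    have "real ?k * (h - ?c)\<^sup>2 \<le> real ?k * (h - ?c)\<^sup>2 + 2 * (h - ?c) * (?S - real ?k * h)"
      using ch S by simp
    also have "\<dots> = (\<Sum>i\<in>A. (h - ?c)\<^sup>2 + 2 * (h - ?c) * (x i - h))"
      by (simp add: sum.distrib sum_subtractf sum_distrib_left[symmetric])
    also have "\<dots> \<le> (\<Sum>i\<in>A. (x i - ?c)\<^sup>2)" by (intro sum_mono tangent)
    also have "\<dots> = ?Q - 2 * ?c * ?S + real ?k * ?c\<^sup>2"
      by (simp add: power2_diff sum.distrib sum_subtractf sum_distrib_left sum_distrib_right mult_ac)
    finally show ?thesis using IH gm A insert.hyps
      by (simp add: power2_sum) (simp add: power2_eq_square algebra_simps)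
  qed
qed

section \<open>The spectrum of a real symmetric matrix\<close>

lemma trace_mult_commute:
  fixes A B :: "'a :: comm_semiring_0 mat"
  assumes "A \<in> carrier_mat n m" "B \<in> carrier_mat m n"
  shows "(\<Sum>i<n. (A * B) $$ (i, i)) = (\<Sum>i<m. (B * A) $$ (i, i))"
proof -
  have "(\<Sum>i<n. (A * B) $$ (i, i)) = (\<Sum>i<n. \<Sum>j<m. A $$ (i, j) * B $$ (j, i))"
    using assms by (intro sum.cong) (auto simp: scalar_prod_def atLeast0LessThan)
  also have "\<dots> = (\<Sum>j<m. \<Sum>i<n. B $$ (j, i) * A $$ (i, j))"
    by (subst sum.swap) (simp add: mult.commute)
  also have "\<dots> = (\<Sum>i<m. (B * A) $$ (i, i))"
    using assms by (intro sum.cong) (auto simp: scalar_prod_def atLeast0LessThan)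
  finally show ?thesis .
qed

text \<open>For j \<noteq> i one of the entries at (i, j) and (j, i) lies below the diagonal, so
  only j = i contributes.\<close>

lemma trace_square_upper_triangular:
  fixes B :: "'a :: comm_semiring_1 mat"
  assumes B: "B \<in> carrier_mat n n" and "upper_triangular B"
  shows "(\<Sum>i<n. (B * B) $$ (i, i)) = (\<Sum>i<n. (B $$ (i, i))\<^sup>2)"
proof (rule sum.cong)
  fix i assume i: "i \<in> {..<n}"
  have "(B * B) $$ (i, i) = (\<Sum>j<n. B $$ (i, j) * B $$ (j, i))"
    using B i by (simp add: scalar_prod_def atLeast0LessThan)
  also have "\<dots> = (\<Sum>j<n. if j = i then (B $$ (i, i))\<^sup>2 else 0)"
  proof (rule sum.cong)
    fix j assume j: "j \<in> {..<n}"
    show "B $$ (i, j) * B $$ (j, i) = (if j = i then (B $$ (i, i))\<^sup>2 else 0)"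
      using assms i j upper_triangularD[OF assms(2), of i j] upper_triangularD[OF assms(2), of j i]
      by (cases i j rule: linorder_cases) (auto simp: power2_eq_square)
  qed simp
  also have "\<dots> = (B $$ (i, i))\<^sup>2" using i by simp
  finally show "(B * B) $$ (i, i) = (B $$ (i, i))\<^sup>2" .
qed simp

text \<open>Schur's theorem gives a similar upper triangular matrix with diagonal \<open>es\<close>.
  The determinant is invariant under similarity, and so is the trace of the square, by cyclicity of
  the trace.\<close>

lemma
  fixes A :: "complex mat"
  assumes A: "A \<in> carrier_mat n n" and es: "char_poly A = (\<Prod>e\<leftarrow>es. [:- e, 1:])"
  shows det_eq_prod_eigenvalues: "det A = prod_list es"
    and trace_square_eq_sum_eigenvalues: "(\<Sum>i<n. (A * A) $$ (i, i)) = (\<Sum>e\<leftarrow>es. e\<^sup>2)"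
proof -
  obtain B P Q where "schur_decomposition A es = (B, P, Q)" by (metis prod_cases3)
  from schur_decomposition[OF A es this] have sim: "similar_mat_wit A B P Q"
    and tri: "upper_triangular B" and diag: "diag_mat B = es" by auto
  note wit = similar_mat_witD2[OF A sim]
  have B: "B \<in> carrier_mat n n" and P: "P \<in> carrier_mat n n" and Q: "Q \<in> carrier_mat n n"
    and QP: "Q * P = 1\<^sub>m n"
    using wit by auto
  have "det A = det B" using sim by (intro det_similar) (auto simp: similar_mat_def)
  then show "det A = prod_list es" using det_upper_triangular[OF tri B] diag by simp
  have BB: "B * B \<in> carrier_mat n n" using B by simp
  have "A * A = P * (B * B) * Q"
    using similar_mat_wit_pow_id[OF sim, of 2] A B by (simp add: numeral_2_eq_2)
  then have "(\<Sum>i<n. (A * A) $$ (i, i)) = (\<Sum>i<n. (Q * (P * (B * B))) $$ (i, i))"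
    using P Q BB by (simp only: trace_mult_commute[of "P * (B * B)" n n Q] mult_carrier_mat)
  also have "Q * (P * (B * B)) = B * B"
    using QP left_mult_one_mat[OF BB] by (simp add: assoc_mult_mat[OF Q P BB, symmetric])
  also have "(\<Sum>i<n. (B * B) $$ (i, i)) = (\<Sum>i<n. (B $$ (i, i))\<^sup>2)"
    by (rule trace_square_upper_triangular[OF B tri])
  also have "\<dots> = (\<Sum>e\<leftarrow>diag_mat B. e\<^sup>2)"
    using B by (simp add: diag_mat_def sum_list_sum_nth atLeast0LessThan)
  finally show "(\<Sum>i<n. (A * A) $$ (i, i)) = (\<Sum>e\<leftarrow>es. e\<^sup>2)" by (simp only: diag)
qed

text \<open>For an eigenvector \<open>v\<close>, the form \<open>q\<close> = v*Av equals its own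
  conjugate by symmetry, hence is real; it also equals \<open>e\<close> times the squared norm
  \<open>N\<close> > 0.\<close>

lemma eigenvalue_real_symmetric_in_Reals:
  fixes A :: "real mat"
  assumes A: "A \<in> carrier_mat n n"
    and sym: "\<And>i j. i < n \<Longrightarrow> j < n \<Longrightarrow> A $$ (i, j) = A $$ (j, i)"
    and "eigenvalue (map_mat complex_of_real A) e"
  shows "e \<in> \<real>"
proof -
  let ?A = "map_mat complex_of_real A"
  obtain v where "eigenvector ?A v e" using assms by (auto simp: eigenvalue_def)
  then have v: "v \<in> carrier_vec n" "v \<noteq> 0\<^sub>v n" and ev: "?A *\<^sub>v v = e \<cdot>\<^sub>v v"
    using A by (auto simp: eigenvector_def)
  have entry: "(\<Sum>j<n. of_real (A $$ (i, j)) * v $ j) = e * v $ i" if "i < n" for i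
    using arg_cong[OF ev, of "\<lambda>w. w $ i"] that v(1) A
    by (simp add: scalar_prod_def atLeast0LessThan)
  define q where "q = (\<Sum>i<n. \<Sum>j<n. cnj (v $ i) * of_real (A $$ (i, j)) * v $ j)"
  define N where "N = (\<Sum>i<n. (cmod (v $ i))\<^sup>2)"
  have "q = (\<Sum>i<n. cnj (v $ i) * (e * v $ i))"
    unfolding q_def by (intro sum.cong) (auto simp: entry[symmetric] sum_distrib_left mult_ac)
  also have "\<dots> = e * of_real N"
    by (simp add: N_def sum_distrib_left mult_ac complex_norm_square del: of_real_power)
  finally have q: "q = e * of_real N" .
  have "cnj q = (\<Sum>i<n. \<Sum>j<n. cnj (v $ j) * of_real (A $$ (i, j)) * v $ i)"
    unfolding q_def by (simp add: mult_ac)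
  also have "\<dots> = q"
    unfolding q_def by (subst sum.swap) (auto intro!: sum.cong simp: sym)
  finally have "q \<in> \<real>" by (simp add: Reals_cnj_iff)
  obtain i where i: "i < n" "v $ i \<noteq> 0" using v by (metis carrier_vecD eq_vecI index_zero_vec)
  have "0 < N" unfolding N_def using i by (intro sum_pos2[of _ i]) auto
  then have "e = q / of_real N" using q by simp
  with \<open>q \<in> \<real>\<close> show ?thesis by simp
qed

text \<open>A list keeps multiplicities and turns the eigenvalues into a family indexed by i < n.
  Their reality allows replacing squared moduli by squares, whose sum is the trace of the squared
  matrix; by symmetry this is the sum of the squared entries.\<close>

lemma real_symmetric_spectrum:
  fixes A :: "real mat"
  assumes A: "A \<in> carrier_mat n n"
    and sym: "\<And>i j. i < n \<Longrightarrow> j < n \<Longrightarrow> A $$ (i, j) = A $$ (j, i)"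
  obtains es where "eigenvalues_mset A = mset es" "length es = n"
    "(\<Prod>i<n. cmod (es ! i)) = \<bar>det A\<bar>"
    "(\<Sum>i<n. (cmod (es ! i))\<^sup>2) = (\<Sum>i<n. \<Sum>j<n. (A $$ (i, j))\<^sup>2)"
proof -
  let ?A = "map_mat complex_of_real A"
  have cA: "?A \<in> carrier_mat n n" using A by simp
  obtain es where es: "char_poly ?A = (\<Prod>e\<leftarrow>es. [:- e, 1:])" and len: "length es = n"
    using char_poly_factorized[OF cA] by blast
  have "proots (\<Prod>e\<leftarrow>fs. [:- e, 1:]) = mset fs" for fs :: "complex list"
  proof (induction fs)
    case (Cons e fs)
    have "(\<Prod>e\<leftarrow>fs. [:- e, 1:]) \<noteq> 0" by (auto simp: prod_list_zero_iff)
    with Cons show ?case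
      by (simp only: list.map prod_list.Cons) (simp add: proots_mult del: mult_pCons_left)
  qed simp
  then have mset: "eigenvalues_mset A = mset es"
    by (simp add: eigenvalues_mset_def es)
  have det: "prod_list es = of_real (det A)"
    using det_eq_prod_eigenvalues[OF cA es] by simp
  have "(\<Prod>i<n. cmod (es ! i)) = cmod (prod_list es)"
    unfolding len[symmetric]
    by (simp add: prod.list_conv_set_nth atLeast0LessThan prod_norm)
  then have prod: "(\<Prod>i<n. cmod (es ! i)) = \<bar>det A\<bar>" by (simp add: det)
  have "e \<in> \<real>" if "e \<in> set es" for e
  proof (rule eigenvalue_real_symmetric_in_Reals[OF A sym])
    show "eigenvalue ?A e"
      unfolding eigenvalue_root_char_poly[OF cA] es using that
      by (auto simp: poly_prod_list prod_list_zero_iff)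
  qed
  then have real: "of_real ((cmod (es ! i))\<^sup>2) = (es ! i)\<^sup>2" if "i < n" for i
    using that len by (metis Reals_cases norm_of_real nth_mem of_real_power power2_abs)
  have "of_real (\<Sum>i<n. (cmod (es ! i))\<^sup>2) = (\<Sum>i<n. (es ! i)\<^sup>2)"
    unfolding of_real_sum using real by (intro sum.cong) auto
  also have "\<dots> = (\<Sum>e\<leftarrow>es. e\<^sup>2)"
    by (simp add: sum_list_sum_nth atLeast0LessThan len)
  also have "\<dots> = (\<Sum>i<n. (?A * ?A) $$ (i, i))"
    by (rule trace_square_eq_sum_eigenvalues[OF cA es, symmetric])
  also have "\<dots> = (\<Sum>i<n. \<Sum>j<n. of_real ((A $$ (i, j))\<^sup>2))"
  proof (rule sum.cong)
    fix i assume i: "i \<in> {..<n}"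
    then have "(?A * ?A) $$ (i, i) = (\<Sum>j<n. of_real (A $$ (i, j)) * of_real (A $$ (j, i)))"
      using A by (simp add: scalar_prod_def atLeast0LessThan)
    also have "\<dots> = (\<Sum>j<n. of_real ((A $$ (i, j))\<^sup>2))"
      using i sym by (intro sum.cong) (auto simp: power2_eq_square)
    finally show "(?A * ?A) $$ (i, i) = (\<Sum>j<n. of_real ((A $$ (i, j))\<^sup>2))" .
  qed simp
  finally have "complex_of_real (\<Sum>i<n. (cmod (es ! i))\<^sup>2)
      = of_real (\<Sum>i<n. \<Sum>j<n. (A $$ (i, j))\<^sup>2)"
    by simp
  then have "(\<Sum>i<n. (cmod (es ! i))\<^sup>2) = (\<Sum>i<n. \<Sum>j<n. (A $$ (i, j))\<^sup>2)"
    by (simp only: of_real_eq_iff)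
  with mset len prod show ?thesis by (rule that)
qed

section \<open>The entries of the ISI matrix\<close>

text \<open>Forgetting the order of a pair is a two-to-one map onto the edges: symmetry supplies the
  reversed pair, and the absence of loops makes it different.\<close>

lemma (in graph) card_arcs_ends: "card (arcs_ends G) = 2 * edge_count G"
proof -
  let ?f = "\<lambda>(u, w). {u, w}"
  have fin: "finite (arcs_ends G)" by (simp add: arcs_ends_def)
  have E: "?f ` arcs_ends G = {{u, w} | u w. u \<rightarrow>\<^bsub>G\<^esub> w}" 
    unfolding image_def by (rule Collect_cong) (metis (mono_tags, lifting) case_prod_conv surj_pair)
  have fibre: "card {p \<in> arcs_ends G. ?f p = e} = 2" if e: "e \<in> ?f ` arcs_ends G" for e
  proof -
    obtain u w where uw: "(u, w) \<in> arcs_ends G" "e = {u, w}" using e by auto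
    then have "(w, u) \<in> arcs_ends G" "u \<noteq> w"
      using arcs_ends_symmetric[OF sym_arcs] adj_not_same by auto
    with uw have "{p \<in> arcs_ends G. ?f p = e} = {(u, w), (w, u)}"
      by (auto simp: doubleton_eq_iff)
    then show ?thesis using \<open>u \<noteq> w\<close> by simp
  qed
  have "card (arcs_ends G) = (\<Sum>e\<in>?f ` arcs_ends G. card {p \<in> arcs_ends G. ?f p = e})"
    using sum.image_gen[OF fin, of "\<lambda>_. 1::nat" ?f] by simp
  also have "\<dots> = (\<Sum>e\<in>?f ` arcs_ends G. 2)" using fibre by (intro sum.cong) auto
  finally show ?thesis by (simp add: edge_count_def E)
qed

definition ISI_weight :: "('a, 'b) pre_digraph \<Rightarrow> 'a \<times> 'a \<Rightarrow> real" where
  "ISI_weight G = (\<lambda>(u, w). real (out_degree G u) * real (out_degree G w) /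
     (real (out_degree G u) + real (out_degree G w)))"

text \<open>The weight is half the harmonic mean of the two degrees, and a mean lies between the
  extremes.\<close>

lemma (in graph) ISI_weight_bounds:
  assumes "p \<in> arcs_ends G"
  shows "real (min_degree G) / 2 \<le> ISI_weight G p" "ISI_weight G p \<le> real (max_degree G) / 2"
proof -
  obtain u w where p: "p = (u, w)" by (cases p)
  have "u \<in> verts G" "w \<in> verts G" using assms adj_in_verts p by auto
  then have lo: "min_degree G \<le> out_degree G u" "min_degree G \<le> out_degree G w"
    and hi: "out_degree G u \<le> max_degree G" "out_degree G w \<le> max_degree G"
    by (auto simp: min_degree_def max_degree_def)
  define a b where "a = real (out_degree G u)" and "b = real (out_degree G w)"
  have ab: "0 \<le> a" "0 \<le> b" "real (min_degree G) \<le> a" "real (min_degree G) \<le> b"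
    "a \<le> real (max_degree G)" "b \<le> real (max_degree G)"
    using lo hi by (auto simp: a_def b_def)
  have W: "ISI_weight G p = a * b / (a + b)" by (simp add: ISI_weight_def p a_def b_def)
  have "real (min_degree G) / 2 \<le> a * b / (a + b) \<and> a * b / (a + b) \<le> real (max_degree G) / 2"
  proof (cases "a + b = 0")
    \<comment> \<open>Here both degrees are 0, which forces the minimum degree to be 0, and the
      quotient is 0 by the convention x / 0 = 0.\<close>
    case True
    then show ?thesis using ab by simp
  next
    case False
    then have "0 < a + b" using ab by simp
    \<comment> \<open>Adding these in pairs bounds 2ab by the extreme degrees times a + b.\<close>
    moreover have "real (min_degree G) * a \<le> b * a" "real (min_degree G) * b \<le> a * b"
      "b * a \<le> real (max_degree G) * a" "a * b \<le> real (max_degree G) * b"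
      using ab by (auto intro: mult_right_mono)
    ultimately show ?thesis by (simp add: field_simps)
  qed
  then show "real (min_degree G) / 2 \<le> ISI_weight G p" "ISI_weight G p \<le> real (max_degree G) / 2"
    by (auto simp: W)
qed

lemma (in graph) ISI_matrix_sum_squares:
  assumes v: "bij_betw v {..<card (verts G)} (verts G)"
  shows "(\<Sum>i<card (verts G). \<Sum>j<card (verts G). (ISI_matrix G v $$ (i, j))\<^sup>2)
    = (\<Sum>p\<in>arcs_ends G. (ISI_weight G p)\<^sup>2)"
proof -
  let ?n = "card (verts G)"
  let ?F = "\<lambda>p. if p \<in> arcs_ends G then (ISI_weight G p)\<^sup>2 else 0"
  have "(\<Sum>i<?n. \<Sum>j<?n. (ISI_matrix G v $$ (i, j))\<^sup>2) = (\<Sum>i<?n. \<Sum>j<?n. ?F (v i, v j))"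
    by (intro sum.cong) (auto simp: ISI_matrix_def ISI_weight_def)
  also have "\<dots> = (\<Sum>i<?n. \<Sum>w\<in>verts G. ?F (v i, w))"
    by (intro sum.cong refl sum.reindex_bij_betw[OF v])
  also have "\<dots> = (\<Sum>u\<in>verts G. \<Sum>w\<in>verts G. ?F (u, w))"
    by (rule sum.reindex_bij_betw[OF v])
  also have "\<dots> = (\<Sum>p\<in>verts G \<times> verts G. ?F p)"
    by (simp add: sum.cartesian_product)
  also have "\<dots> = (\<Sum>p\<in>arcs_ends G. (ISI_weight G p)\<^sup>2)"
    using adj_in_verts by (intro sum.mono_neutral_cong_right) auto
  finally show ?thesis .
qed

theorem theorem4p6:
  fixes G :: "('a, 'b) pre_digraph" and v :: "nat \<Rightarrow> 'a"
    and n m \<delta> \<Delta> :: nat and \<Theta> :: real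
  assumes "graph G" and "verts G \<noteq> {}"
    and "n = card (verts G)"
    and "bij_betw v {..<n} (verts G)"
    and "m = edge_count G"
    and "\<delta> = min_degree G"
    and "\<Delta> = max_degree G"
    and "\<Theta> = det (ISI_matrix G v)"
  shows "sqrt (real m * (real \<delta>)\<^sup>2 / 2 + real n * (real n - 1) * \<bar>\<Theta>\<bar> powr (2 / real n))
           \<le> ISI_energy G v \<and>
         ISI_energy G v
           \<le> sqrt (real m * (real n - 1) * ((real \<Delta>)\<^sup>2 / 2) + real n * \<bar>\<Theta>\<bar> powr (2 / real n))"
proof -
  interpret graph G by fact
  let ?S = "ISI_matrix G v"
  have n: "0 < n" using assms by (simp add: card_gt_0_iff)
  have S: "?S \<in> carrier_mat n n" by (simp add: ISI_matrix_def assms)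
  have sym: "?S $$ (i, j) = ?S $$ (j, i)" if "i < n" "j < n" for i j
    using that arcs_ends_symmetric[OF sym_arcs]
    by (auto simp: ISI_matrix_def assms mult.commute add.commute)
  obtain es where es: "eigenvalues_mset ?S = mset es" "length es = n"
    and prod: "(\<Prod>i<n. cmod (es ! i)) = \<bar>\<Theta>\<bar>"
    and sq: "(\<Sum>i<n. (cmod (es ! i))\<^sup>2) = (\<Sum>i<n. \<Sum>j<n. (?S $$ (i, j))\<^sup>2)"
    using real_symmetric_spectrum[OF S sym] unfolding assms(8) by blast
  have "ISI_energy G v = (\<Sum>e\<leftarrow>es. cmod e)"
    unfolding ISI_energy_def es(1) by (simp flip: mset_map sum_mset_sum_list)
  then have E: "ISI_energy G v = (\<Sum>i<n. cmod (es ! i))"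
    by (simp add: sum_list_sum_nth es atLeast0LessThan)
  define F where "F = (\<Sum>i<n. (cmod (es ! i))\<^sup>2)"
  have F: "F = (\<Sum>p\<in>arcs_ends G. (ISI_weight G p)\<^sup>2)"
    unfolding F_def sq using ISI_matrix_sum_squares assms by simp
  have "(real \<delta> / 2)\<^sup>2 \<le> (ISI_weight G p)\<^sup>2" "(ISI_weight G p)\<^sup>2 \<le> (real \<Delta> / 2)\<^sup>2"
    if "p \<in> arcs_ends G" for p
    using ISI_weight_bounds[OF that] assms by (auto intro!: power_mono)
  then have "(\<Sum>p\<in>arcs_ends G. (real \<delta> / 2)\<^sup>2) \<le> F" "F \<le> (\<Sum>p\<in>arcs_ends G. (real \<Delta> / 2)\<^sup>2)"
    unfolding F by (intro sum_mono, blast)+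
  \<comment> \<open>There are 2m ordered adjacent pairs, and 2m(\<delta>/2)^2 = m\<delta>^2/2;
    likewise for \<Delta>.\<close>
  then have F_bounds: "real m * (real \<delta>)\<^sup>2 / 2 \<le> F" "F \<le> real m * ((real \<Delta>)\<^sup>2 / 2)"
    by (auto simp: card_arcs_ends assms power_divide)
  define g where "g = root n \<bar>\<Theta>\<bar>"
  have g: "0 \<le> g" "g ^ card {..<n} = (\<Prod>i<n. cmod (es ! i))"
    using n by (auto simp: g_def prod)
  have g2: "g\<^sup>2 = \<bar>\<Theta>\<bar> powr (2 / real n)"
  \<comment> \<open>Writing the root as a \<open>powr\<close> requires a positive base; for \<Theta>
    = 0 both sides vanish since 0 \<open>powr\<close> anything is 0.\<close>
  proof (cases "\<Theta> = 0")
    case False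
    then have "g = \<bar>\<Theta>\<bar> powr (1 / real n)" using n by (simp add: g_def root_powr_inverse)
    then show ?thesis by (simp add: power2_eq_square flip: powr_add)
  qed (simp add: g_def)
  have E0: "0 \<le> ISI_energy G v" unfolding E by (intro sum_nonneg) simp
  have "F + real n * (real n - 1) * g\<^sup>2 \<le> (ISI_energy G v)\<^sup>2"
    using kober_lower[of "{..<n}" "\<lambda>i. cmod (es ! i)" g] g n by (simp add: E F_def lessThan_empty_iff)
  then have lower: "real m * (real \<delta>)\<^sup>2 / 2 + real n * (real n - 1) * g\<^sup>2 \<le> (ISI_energy G v)\<^sup>2"
    using F_bounds by linarith
  have "(ISI_energy G v)\<^sup>2 \<le> (real n - 1) * F + real n * g\<^sup>2"
    using kober_upper[of "{..<n}" "\<lambda>i. cmod (es ! i)" g] g n by (simp add: E F_def lessThan_empty_iff)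
  \<comment> \<open>The factor n - 1 is nonnegative because the graph has a vertex.\<close>
  also have "(real n - 1) * F \<le> (real n - 1) * (real m * ((real \<Delta>)\<^sup>2 / 2))"
    using F_bounds n by (intro mult_left_mono) auto
  finally have "(ISI_energy G v)\<^sup>2 \<le> real m * (real n - 1) * ((real \<Delta>)\<^sup>2 / 2) + real n * g\<^sup>2"
    by (simp add: mult_ac)
  with lower show ?thesis
    using E0 by (auto simp: g2 intro!: real_le_rsqrt real_le_lsqrt)
qed

end
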